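(* Let $p,q,\upsilon,\gamma_1,\dots,\gamma_6,\tau,w\in\mathbb{C}$ with $\operatorname{Re}(p)>0$, $\operatorname{Re}(q)>0$, $\operatorname{Re}(\upsilon)>0$, $\gamma_4,\gamma_5,\gamma_6\notin\{0,-1,-2,\dots\}$, $\operatorname{Re}(\tau)\ge0$ and $\operatorname{Re}(q-\tau)\ge0$. Let $b\in\mathbb{R}$ and $t>b$. Then $${}_{t}D_{b^{+}}^{\tau}\left[(t-b)^{q-1}E_{\gamma_{4},\gamma_{5},\gamma_{6};p;q;\upsilon}^{(\gamma_{1};\gamma_{2};\gamma_{3})}(z,w(t-b))\right]=(t-b)^{q-\tau-1}E_{\gamma_{4},\gamma_{5},\gamma_{6};p;q-\tau;\upsilon}^{(\gamma_{1};\gamma_{2};\gamma_{3})}(z,w(t-b)).$$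
   Context: $(a)_n$ is the Pochhammer symbol. The modified bivariate I-Konhauser Mittag-Leffler function is $$E_{\gamma_{4},\gamma_{5},\gamma_{6};p;q;\upsilon}^{(\gamma_{1};\gamma_{2};\gamma_{3})}(z,t)=\sum_{l=0}^{\infty}\sum_{n=0}^{\infty}\frac{(-1)^{l}(\gamma_{1})_{2l}(\gamma_{2})_{l+n}(\gamma_{3})_{l}\,z^{l}t^{\upsilon n}}{(\gamma_{4})_{l}(\gamma_{5})_{l}(\gamma_{6})_{l}\,\Gamma(p+l)\,\Gamma(q+\upsilon n)\,n!\,l!};$$ the same series is used when the parameter $q$ has real part $0$, with $1/\Gamma=0$ at poles of $\Gamma$. For $s>0$, $(ws)^{\upsilon n}$ means $(w^{\upsilon})^n s^{\upsilon n}$ with a fixed choice of $w^\upsilon$ (and $w^{\upsilon}=0$ if $w=0$). The Riemann-Liouville fractional integral is ${}_{t}\mathbb{I}_{b^{+}}^{\sigma}[h](t)=\frac{1}{\Gamma(\sigma)}\int_b^t(t-y)^{\sigma-1}h(y)\,dy$ ($\operatorname{Re}\sigma>0$, $t>b$), and the Riemann-Liouville (partial) fractional derivative is ${}_{t}D_{b^{+}}^{\tau}[h]=\left(\frac{\partial}{\partial t}\right)^{m}{}_{t}\mathbb{I}_{b^{+}}^{m-\tau}[h]$ with $m=[\operatorname{Re}(\tau)]+1$, $[\cdot]$ being the integer part. *)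

theory Defs
  imports "HOL-Analysis.Analysis"
begin

text \<open>
  The argument \<open>w * s\<close> with \<open>s > 0\<close> enters the series only through the powers
  \<open>(w * s)\<^sup>\<upsilon>\<^sup>n = (w\<^sup>\<upsilon>)\<^sup>n * s\<^sup>\<upsilon>\<^sup>n\<close>, where \<open>w\<^sup>\<upsilon>\<close> is any fixed value of the
  complex power, that is, \<open>exp (\<upsilon> * L)\<close> for some logarithm \<open>L\<close> of \<open>w\<close>.
\<close>

definition is_power_value :: "complex \<Rightarrow> complex \<Rightarrow> complex \<Rightarrow> bool" where
  "is_power_value w \<upsilon> W \<longleftrightarrow>
     (if w = 0 then W = 0 else (\<exists>L. exp L = w \<and> W = exp (\<upsilon> * L)))"

text \<open>
  \<open>IKML \<gamma>1 \<gamma>2 \<gamma>3 \<gamma>4 \<gamma>5 \<gamma>6 p q \<upsilon> z W s\<close> is the modified bivariate I-Konhauser Mittag-Leffler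
  function at \<open>(z, w * s)\<close>, where \<open>W\<close> is the chosen value of \<open>w\<^sup>\<upsilon>\<close>. The function
  \<open>rGamma\<close> is the entire function \<open>1 / \<Gamma>\<close>, which vanishes at the poles of \<open>\<Gamma>\<close>.
\<close>

definition IKML ::
  "complex \<Rightarrow> complex \<Rightarrow> complex \<Rightarrow> complex \<Rightarrow> complex \<Rightarrow> complex \<Rightarrow>
   complex \<Rightarrow> complex \<Rightarrow> complex \<Rightarrow> complex \<Rightarrow> complex \<Rightarrow> real \<Rightarrow> complex" where
  "IKML \<gamma>1 \<gamma>2 \<gamma>3 \<gamma>4 \<gamma>5 \<gamma>6 p q \<upsilon> z W s =
     (\<Sum>l. \<Sum>n.
        (-1) ^ l * pochhammer \<gamma>1 (2 * l) * pochhammer \<gamma>2 (l + n) * pochhammer \<gamma>3 l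
          * z ^ l * (W ^ n * of_real s powr (\<upsilon> * of_nat n))
          * rGamma (p + of_nat l) * rGamma (q + \<upsilon> * of_nat n)
        / (pochhammer \<gamma>4 l * pochhammer \<gamma>5 l * pochhammer \<gamma>6 l * fact n * fact l))"

definition RL_integrand :: "complex \<Rightarrow> (real \<Rightarrow> complex) \<Rightarrow> real \<Rightarrow> real \<Rightarrow> complex" where
  "RL_integrand \<sigma> h t y = of_real (t - y) powr (\<sigma> - 1) * h y"

definition RL_integral :: "real \<Rightarrow> complex \<Rightarrow> (real \<Rightarrow> complex) \<Rightarrow> real \<Rightarrow> complex" where
  "RL_integral b \<sigma> h t = 1 / Gamma \<sigma> * (LINT y:{b..t}|lborel. RL_integrand \<sigma> h t y)"

definition iter_deriv :: "nat \<Rightarrow> (real \<Rightarrow> complex) \<Rightarrow> real \<Rightarrow> complex" where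
  "iter_deriv m = (\<lambda>g x. vector_derivative g (at x)) ^^ m"

definition RL_order :: "complex \<Rightarrow> nat" where
  "RL_order \<tau> = nat \<lfloor>Re \<tau>\<rfloor> + 1"

definition RL_deriv :: "real \<Rightarrow> complex \<Rightarrow> (real \<Rightarrow> complex) \<Rightarrow> real \<Rightarrow> complex" where
  "RL_deriv b \<tau> h = iter_deriv (RL_order \<tau>) (RL_integral b (of_nat (RL_order \<tau>) - \<tau>) h)"

text \<open>
  Integrals and derivatives are total functions in HOL, so a bare equation for \<open>RL_deriv\<close>
  does not say that the defining integral converges and that the \<open>m\<close> derivatives exist;
  this predicate does.
\<close>

definition RL_deriv_exists :: "real \<Rightarrow> complex \<Rightarrow> (real \<Rightarrow> complex) \<Rightarrow> bool" where
  "RL_deriv_exists b \<tau> h \<longleftrightarrow>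
     (let \<sigma> = of_nat (RL_order \<tau>) - \<tau> in
       (\<forall>x>b. set_integrable lborel {b..x} (RL_integrand \<sigma> h x)) \<and>
       (\<forall>k<RL_order \<tau>. \<forall>x>b. iter_deriv k (RL_integral b \<sigma> h) differentiable (at x)))"

end

theory Submission
  imports Defs
begin

text \<open>
  The powers \<open>(y - b) powr (\<mu> - 1)\<close>, normalised by \<open>rGamma \<mu>\<close>, form a family on which fractional
  calculus acts by shifting the exponent. The fractional integral of order \<open>\<sigma>\<close> takes \<open>\<mu>\<close> to
  \<open>\<mu> + \<sigma>\<close> when \<open>Re \<mu>, Re \<sigma> > 0\<close>, which is Euler's Beta integral with complex parameters. The
  ordinary derivative takes \<open>\<mu>\<close> to \<open>\<mu> - 1\<close> for every complex \<open>\<mu>\<close>, because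
  \<open>(\<mu> - 1) * rGamma \<mu> = rGamma (\<mu> - 1)\<close> also holds where \<open>\<Gamma>\<close> has poles. The parameter \<open>q\<close> enters
  the bivariate Mittag-Leffler function only through \<open>rGamma (q + \<upsilon> * n)\<close>, so the function
  \<open>s powr (q - 1) * E (z, w s)\<close> is a superposition of such powers with \<open>\<mu> = q + \<upsilon> * n\<close> and with
  coefficients independent of \<open>q\<close>. Integrating to order \<open>m - \<tau>\<close> and then differentiating \<open>m\<close> times
  replaces \<open>q\<close> by \<open>q + (m - \<tau>) - m = q - \<tau>\<close>.

  The analytic work is to justify acting term by term. Summing over \<open>l\<close> first
  (\<open>IKML_eq_rGamma_power_series\<close>) leaves a single series
  \<open>\<Sum>n. a n * rGamma (q + \<upsilon> * n) * u ^ n\<close> in \<open>u = s powr \<upsilon>\<close>, where \<open>a\<close> grows at most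
  geometrically. This is an entire function of \<open>u\<close>: the bound
  \<open>\<bar>Beta a b\<bar> \<le> Beta (Re a) (Re b)\<close>, read as an upper bound for the quotient
  \<open>rGamma (a + b) / rGamma a\<close> with \<open>b = \<upsilon>\<close>, makes the ratio test apply
  (\<open>summable_rGamma_progression\<close>). Differentiation is then that of a power series composed with \<open>s powr \<upsilon>\<close>
  (\<open>rGamma_power_series_has_vector_derivative\<close>), and the fractional integral is exchanged with the
  sum by dominated convergence (\<open>RL_integral_rGamma_power_series\<close>).
\<close>

section \<open>The Beta integral with complex parameters\<close>

text \<open>
  The complex power jumps across the negative axis, so continuity does not give measurability;
  on the real line it is nevertheless piecewise an exponential of a logarithm.
\<close>

lemma borel_measurable_of_real_powr [measurable]:
  "(\<lambda>t::real. complex_of_real t powr z) \<in> borel_measurable borel"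
proof -
  have "complex_of_real t powr z =
      (if t = 0 then 0 else exp (z * (of_real (ln \<bar>t\<bar>) + (if t < 0 then \<i> * pi else 0))))" for t
  proof (cases "t < 0")
    case True
    then have "Ln (of_real t) = of_real (ln \<bar>t\<bar>) + \<i> * pi"
      using Ln_of_real[of "-t"] Ln_minus[of "of_real (-t)"] by (auto simp: complex_eq_iff)
    then show ?thesis using True by (simp add: powr_def)
  next
    case False
    then show ?thesis by (auto simp: powr_def Ln_of_real)
  qed
  then show ?thesis by simp
qed

lemma norm_of_real_powr: "0 \<le> t \<Longrightarrow> norm (complex_of_real t powr z) = t powr Re z"
  by (simp add: norm_powr_real_powr)

lemma set_integrable_Beta_kernel:
  assumes "Re \<sigma> > 0" "Re \<mu> > 0"
  shows "set_integrable lborel {0..1}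
           (\<lambda>s. complex_of_real (1 - s) powr (\<sigma> - 1) * of_real s powr (\<mu> - 1))"
  unfolding set_integrable_def
proof (rule Bochner_Integration.integrable_bound)
  show "integrable lborel (\<lambda>s. indicat_real {0..1} s *\<^sub>R (s powr (Re \<mu> - 1) * (1 - s) powr (Re \<sigma> - 1)))"
    using integrable_Beta[OF assms(2,1)] by (simp add: set_integrable_def)
qed (auto simp: indicator_def norm_mult norm_of_real_powr simp del: of_real_diff intro!: AE_I2)

text \<open>
  The substitution \<open>y = b + (x - b) * s\<close> reduces the convolution of two powers on an arbitrary
  interval to the unit interval. It is used twice: on \<open>{0..u}\<close> in the evaluation of the Beta integral
  and on \<open>{b..x}\<close> for the fractional integral of a power.
\<close>

lemma Beta_kernel_rescale:
  assumes "b < x" "Re \<sigma> > 0" "Re \<mu> > 0"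
  defines "k \<equiv> \<lambda>y. complex_of_real (x - y) powr (\<sigma> - 1) * of_real (y - b) powr (\<mu> - 1)"
  shows "set_integrable lborel {b..x} k"
    and "(LINT y:{b..x}|lborel. k y) = of_real (x - b) powr (\<mu> + \<sigma> - 1) *
           (LINT s:{0..1}|lborel. of_real (1 - s) powr (\<sigma> - 1) * of_real s powr (\<mu> - 1))"
proof -
  define k1 where "k1 = (\<lambda>s. complex_of_real (1 - s) powr (\<sigma> - 1) * of_real s powr (\<mu> - 1))"
  have k: "indicat_real {b..x} (b + (x - b) * s) *\<^sub>R k (b + (x - b) * s) =
      of_real (x - b) powr (\<mu> + \<sigma> - 2) * (indicat_real {0..1} s *\<^sub>R k1 s)" for s
  proof (cases "s \<in> {0..1}")
    case True
    have "b + (x - b) * s \<le> b + (x - b) * 1"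
      using True \<open>b < x\<close> by (intro add_left_mono mult_left_mono) auto
    then have ind: "b + (x - b) * s \<in> {b..x}" using True \<open>b < x\<close> by simp
    have "x - (b + (x - b) * s) = (x - b) * (1 - s)" by (simp add: algebra_simps)
    then have "k (b + (x - b) * s) =
        of_real ((x - b) * (1 - s)) powr (\<sigma> - 1) * of_real ((x - b) * s) powr (\<mu> - 1)"
      by (simp only: k_def add_diff_cancel_left')
    also have "\<dots> = (of_real (x - b) powr (\<sigma> - 1) * of_real (1 - s) powr (\<sigma> - 1)) *
        (of_real (x - b) powr (\<mu> - 1) * of_real s powr (\<mu> - 1))"
      using True \<open>b < x\<close> by (simp add: powr_times_real del: of_real_diff)
    also have "\<dots> = (of_real (x - b) powr (\<sigma> - 1) * of_real (x - b) powr (\<mu> - 1)) * k1 s"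
      by (simp add: k1_def)
    also have "of_real (x - b) powr (\<sigma> - 1) * of_real (x - b) powr (\<mu> - 1) =
        complex_of_real (x - b) powr (\<mu> + \<sigma> - 2)"
      by (simp add: powr_add [symmetric] algebra_simps)
    finally show ?thesis using True ind by simp
  next
    case False
    have "b + (x - b) * s \<notin> {b..x}"
    proof
      assume "b + (x - b) * s \<in> {b..x}"
      then have "0 \<le> (x - b) * s" "(x - b) * s \<le> (x - b) * 1" by auto
      then show False using False \<open>b < x\<close> by (auto simp: zero_le_mult_iff mult_le_cancel_left)
    qed
    then show ?thesis using False by simp
  qed
  have "set_integrable lborel {0..1} k1"
    unfolding k1_def by (rule set_integrable_Beta_kernel) fact+
  then have "integrable lborel (\<lambda>s. indicat_real {b..x} (b + (x - b) * s) *\<^sub>R k (b + (x - b) * s))"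
    unfolding k set_integrable_def by (intro integrable_mult_right)
  then show "set_integrable lborel {b..x} k"
    using lborel_integrable_real_affine_iff[of "x - b" "\<lambda>y. indicat_real {b..x} y *\<^sub>R k y" b] \<open>b < x\<close>
    by (simp add: set_integrable_def)
  have "(LINT y:{b..x}|lborel. k y) =
      of_real (x - b) * (of_real (x - b) powr (\<mu> + \<sigma> - 2) * (LINT s:{0..1}|lborel. k1 s))"
    unfolding set_lebesgue_integral_def
    using \<open>b < x\<close> lborel_integral_real_affine[of "x - b" "\<lambda>y. indicat_real {b..x} y *\<^sub>R k y" b]
    by (simp only: k integral_mult_right_zero) (simp add: scaleR_conv_of_real)
  also have "\<dots> = of_real (x - b) powr (\<mu> + \<sigma> - 1) * (LINT s:{0..1}|lborel. k1 s)"
  proof -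
    have "complex_of_real (x - b) powr (\<mu> + \<sigma> - 1) =
        of_real (x - b) powr 1 * of_real (x - b) powr (\<mu> + \<sigma> - 2)"
      by (simp only: powr_add [symmetric]) (simp add: algebra_simps)
    then show ?thesis using \<open>b < x\<close> by (simp del: of_real_diff)
  qed
  finally show "(LINT y:{b..x}|lborel. k y) = of_real (x - b) powr (\<mu> + \<sigma> - 1) *
           (LINT s:{0..1}|lborel. of_real (1 - s) powr (\<sigma> - 1) * of_real s powr (\<mu> - 1))"
    by (simp add: k1_def)
qed

lemma Gamma_density_integral:
  assumes "Re z > 0"
  defines "g \<equiv> \<lambda>t. indicat_real {0<..} t *\<^sub>R (complex_of_real t powr (z - 1) / of_real (exp t))"
  shows "integrable lborel g" "integral\<^sup>L lborel g = Gamma z"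
proof -
  have "set_integrable lebesgue {0<..} (\<lambda>t. complex_of_real t powr (z - 1) / of_real (exp t))"
    using absolutely_integrable_Gamma_integral'[OF assms(1)] by simp
  then have "integrable lebesgue g"
    by (simp add: set_integrable_def g_def)
  then show *: "integrable lborel g"
    by (subst (asm) integrable_completion) (auto simp: g_def)
  have "set_integrable lborel {0<..} (\<lambda>t. complex_of_real t powr (z - 1) / of_real (exp t))"
    using * by (simp add: set_integrable_def g_def)
  from set_borel_integral_eq_integral(2)[OF this] Gamma_integral_complex'[OF assms(1)]
  show "integral\<^sup>L lborel g = Gamma z"
    by (simp add: set_lebesgue_integral_def g_def integral_unique)
qed

lemma Re_pos_not_nonpos_Int: "Re z > 0 \<Longrightarrow> z \<notin> \<int>\<^sub>\<le>\<^sub>0"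
  by (auto elim!: nonpos_Ints_cases)

text \<open>
  The densities \<open>t powr (z - 1) * exp (-t)\<close> on the half-line have integral \<open>Gamma z\<close>, and by
  \<open>Beta_kernel_rescale\<close> the convolution of those with parameters \<open>\<mu>\<close> and \<open>\<sigma>\<close> is the one with
  parameter \<open>\<mu> + \<sigma>\<close>, multiplied by the Beta integral. Since the integral of a convolution is the
  product of the integrals, Fubini's theorem yields \<open>Gamma \<mu> * Gamma \<sigma> = Gamma (\<mu> + \<sigma>) * B\<close>.
\<close>

lemma Beta_integral_complex:
  assumes \<sigma>: "Re \<sigma> > 0" and \<mu>: "Re \<mu> > 0"
  shows "(LINT s:{0..1}|lborel. complex_of_real (1 - s) powr (\<sigma> - 1) * of_real s powr (\<mu> - 1)) =
    Beta \<mu> \<sigma>" (is "?B = _")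
proof -
  define g where "g = (\<lambda>z t. indicat_real {0<..} t *\<^sub>R (complex_of_real t powr (z - 1) / of_real (exp t)))"
  have g: "integrable lborel (g z)" "integral\<^sup>L lborel (g z) = Gamma z" if "Re z > 0" for z
    using Gamma_density_integral[OF that] by (simp_all add: g_def)
  have [measurable]: "g z \<in> borel_measurable borel" for z
    by (simp add: g_def)
  have shift: "integrable lborel (\<lambda>u. f (u - t))" "(\<integral>u. f (u - t) \<partial>lborel) = integral\<^sup>L lborel f"
    if "integrable lborel f" for f :: "real \<Rightarrow> 'b :: {banach, second_countable_topology}" and t
  proof -
    have "(\<lambda>u. f (u - t)) = (\<lambda>u. f (- t + 1 * u))" by simp
    then show "integrable lborel (\<lambda>u. f (u - t))"
      using lborel_integrable_real_affine[OF that, of 1 "-t"] by simp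
    show "(\<integral>u. f (u - t) \<partial>lborel) = integral\<^sup>L lborel f"
      using lborel_integral_real_affine[of 1 f "-t"] by simp
  qed
  have int2: "integrable (lborel \<Otimes>\<^sub>M lborel) (\<lambda>(t, u). g \<mu> t * g \<sigma> (u - t))"
  proof (rule lborel_pair.Fubini_integrable)
    show "(\<lambda>(t, u). g \<mu> t * g \<sigma> (u - t)) \<in> borel_measurable (lborel \<Otimes>\<^sub>M lborel)"
      by measurable
    show "integrable lborel (\<lambda>t. \<integral>u. norm (case (t, u) of (t, u) \<Rightarrow> g \<mu> t * g \<sigma> (u - t)) \<partial>lborel)"
      using shift(2)[OF integrable_norm[OF g(1)[OF \<sigma>]]] integrable_norm[OF g(1)[OF \<mu>]]
      by (simp add: norm_mult)
    show "AE t in lborel. integrable lborel (\<lambda>u. case (t, u) of (t, u) \<Rightarrow> g \<mu> t * g \<sigma> (u - t))"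
      using shift(1)[OF g(1)[OF \<sigma>]] by simp
  qed
  have conv: "(\<integral>t. g \<mu> t * g \<sigma> (u - t) \<partial>lborel) = g (\<mu> + \<sigma>) u * ?B" for u
  proof (cases "u > 0")
    case True
    have "(\<integral>t. g \<mu> t * g \<sigma> (u - t) \<partial>lborel) =
        (\<integral>t. (1 / of_real (exp u)) * (indicat_real {0..u} t *\<^sub>R
           (of_real (u - t) powr (\<sigma> - 1) * of_real (t - 0) powr (\<mu> - 1))) \<partial>lborel)"
    proof (rule Bochner_Integration.integral_cong)
      fix t
      show "g \<mu> t * g \<sigma> (u - t) = (1 / of_real (exp u)) * (indicat_real {0..u} t *\<^sub>R
           (of_real (u - t) powr (\<sigma> - 1) * of_real (t - 0) powr (\<mu> - 1)))"
        using True by (auto simp: g_def indicator_def exp_diff simp flip: exp_of_real)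
    qed simp
    also have "\<dots> = (1 / of_real (exp u)) * (LINT t:{0..u}|lborel.
           of_real (u - t) powr (\<sigma> - 1) * of_real (t - 0) powr (\<mu> - 1))"
      unfolding set_lebesgue_integral_def by (rule integral_mult_right_zero)
    also have "\<dots> = (1 / of_real (exp u)) * (of_real (u - 0) powr (\<mu> + \<sigma> - 1) * ?B)"
      by (subst Beta_kernel_rescale(2)[OF True \<sigma> \<mu>]) (rule refl)
    also have "\<dots> = g (\<mu> + \<sigma>) u * ?B"
      using True by (simp add: g_def)
    finally show ?thesis .
  next
    case False
    then have "(\<lambda>t. g \<mu> t * g \<sigma> (u - t)) = (\<lambda>_. 0)"
      by (auto simp: g_def indicator_def)
    then have "(\<integral>t. g \<mu> t * g \<sigma> (u - t) \<partial>lborel) = 0" by (simp only: integral_zero)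
    then show ?thesis using False by (simp add: g_def)
  qed
  have "Gamma (\<mu> + \<sigma>) * ?B = (\<integral>u. g (\<mu> + \<sigma>) u * ?B \<partial>lborel)"
    using g(2)[of "\<mu> + \<sigma>"] assms by simp
  also have "\<dots> = (\<integral>u. (\<integral>t. g \<mu> t * g \<sigma> (u - t) \<partial>lborel) \<partial>lborel)"
    by (simp only: conv)
  also have "\<dots> = (\<integral>t. (\<integral>u. g \<mu> t * g \<sigma> (u - t) \<partial>lborel) \<partial>lborel)"
    by (rule lborel_pair.Fubini_integral[OF int2])
  also have "\<dots> = (\<integral>t. g \<mu> t * Gamma \<sigma> \<partial>lborel)"
    using shift(2)[OF g(1)[OF \<sigma>]] g(2)[OF \<sigma>] by simp
  also have "\<dots> = Gamma \<mu> * Gamma \<sigma>"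
    using g(2)[OF \<mu>] by simp
  finally have "Gamma (\<mu> + \<sigma>) * ?B = Gamma \<mu> * Gamma \<sigma>" .
  moreover have "Gamma (\<mu> + \<sigma>) \<noteq> 0"
    using assms by (simp add: Gamma_eq_zero_iff Re_pos_not_nonpos_Int)
  ultimately show ?thesis by (simp add: Beta_def field_simps)
qed

text \<open>
  The fractional integral of a power, before division by \<open>Gamma \<sigma>\<close>. The third claim controls the
  \<open>L\<^sup>1\<close> norm: taking absolute values replaces the parameters by their real parts.
\<close>

lemma RL_kernel_power:
  assumes "b < x" "Re \<sigma> > 0" "Re \<mu> > 0"
  defines "k \<equiv> \<lambda>y. complex_of_real (x - y) powr (\<sigma> - 1) * of_real (y - b) powr (\<mu> - 1)"
  shows "set_integrable lborel {b..x} k"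
    and "(LINT y:{b..x}|lborel. k y) = Beta \<mu> \<sigma> * of_real (x - b) powr (\<mu> + \<sigma> - 1)"
    and "(LINT y:{b..x}|lborel. norm (k y)) =
           Beta (Re \<mu>) (Re \<sigma>) * (x - b) powr (Re \<mu> + Re \<sigma> - 1)"
proof -
  show "set_integrable lborel {b..x} k"
    unfolding k_def by (rule Beta_kernel_rescale) fact+
  have int: "(LINT y:{b..x}|lborel. complex_of_real (x - y) powr (\<sigma> - 1) * of_real (y - b) powr (\<mu> - 1))
      = Beta \<mu> \<sigma> * of_real (x - b) powr (\<mu> + \<sigma> - 1)"
    if "Re \<sigma> > 0" "Re \<mu> > 0" for \<sigma> \<mu>
    using Beta_kernel_rescale(2)[OF \<open>b < x\<close> that] Beta_integral_complex[OF that] by simp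
  show "(LINT y:{b..x}|lborel. k y) = Beta \<mu> \<sigma> * of_real (x - b) powr (\<mu> + \<sigma> - 1)"
    unfolding k_def by (rule int) fact+
  have "complex_of_real (LINT y:{b..x}|lborel. norm (k y)) =
      (LINT y:{b..x}|lborel. of_real (norm (k y)))"
    unfolding set_lebesgue_integral_def
    by (subst integral_complex_of_real [symmetric]) (simp add: scaleR_conv_of_real)
  also have "\<dots> = (LINT y:{b..x}|lborel.
      complex_of_real (x - y) powr (of_real (Re \<sigma>) - 1) * of_real (y - b) powr (of_real (Re \<mu>) - 1))"
  proof (rule set_lebesgue_integral_cong)
    have "complex_of_real (norm (k y)) =
        complex_of_real (x - y) powr (of_real (Re \<sigma>) - 1) * of_real (y - b) powr (of_real (Re \<mu>) - 1)"
      if "y \<in> {b..x}" for y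
    proof -
      have "norm (k y) = (x - y) powr (Re \<sigma> - 1) * (y - b) powr (Re \<mu> - 1)"
        using that by (simp add: k_def norm_mult norm_of_real_powr del: of_real_diff)
      also have "complex_of_real \<dots> = complex_of_real (x - y) powr of_real (Re \<sigma> - 1) *
          of_real (y - b) powr of_real (Re \<mu> - 1)"
        using that powr_of_real[of "x - y" "Re \<sigma> - 1"] powr_of_real[of "y - b" "Re \<mu> - 1"]
        by (simp only: of_real_mult) simp
      finally show ?thesis by simp
    qed
    then show "\<forall>y. y \<in> {b..x} \<longrightarrow> complex_of_real (norm (k y)) =
        complex_of_real (x - y) powr (of_real (Re \<sigma>) - 1) * of_real (y - b) powr (of_real (Re \<mu>) - 1)"
      by blast
  qed simp
  also have "\<dots> = Beta (of_real (Re \<mu>)) (of_real (Re \<sigma>)) *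
      of_real (x - b) powr (of_real (Re \<mu>) + of_real (Re \<sigma>) - 1)"
    by (rule int) (use assms in auto)
  also have "\<dots> = of_real (Beta (Re \<mu>) (Re \<sigma>) * (x - b) powr (Re \<mu> + Re \<sigma> - 1))"
    using \<open>b < x\<close> powr_of_real[of "x - b" "Re \<mu> + Re \<sigma> - 1"] by (simp add: Beta_complex_of_real)
  finally show "(LINT y:{b..x}|lborel. norm (k y)) =
           Beta (Re \<mu>) (Re \<sigma>) * (x - b) powr (Re \<mu> + Re \<sigma> - 1)"
    by (simp only: of_real_eq_iff)
qed

section \<open>Decay of the reciprocal Gamma function along arithmetic progressions\<close>

lemma norm_Beta_le:
  assumes "Re \<mu> > 0" "Re \<sigma> > 0"
  shows "norm (Beta \<mu> \<sigma>) \<le> Beta (Re \<mu>) (Re \<sigma>)"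
proof -
  define k where "k = (\<lambda>y. complex_of_real (1 - y) powr (\<sigma> - 1) * of_real (y - 0) powr (\<mu> - 1))"
  note k = RL_kernel_power[of 0 1 \<sigma> \<mu>, OF zero_less_one assms(2,1), folded k_def]
  have "norm (LINT y:{0..1}|lborel. k y) \<le> (LINT y:{0..1}|lborel. norm (k y))"
    using k(1) by (intro set_integral_norm_bound) auto
  then show ?thesis unfolding k(2) using k(3) by (simp add: k_def)
qed

text \<open>
  An upper bound for \<open>rGamma\<close> means a lower bound for \<open>\<bar>\<Gamma>\<bar>\<close>, which the integral for \<open>\<Gamma>\<close> does not
  give directly. It comes instead from \<open>rGamma (a + b) = Beta a b * rGamma a * rGamma b\<close>, where the
  triangle inequality bounds the Beta factor.
\<close>

lemma norm_rGamma_add_le: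
  assumes "Re a > 0" "Re b > 0"
  shows "norm (rGamma (a + b)) \<le> Beta (Re a) (Re b) * norm (rGamma b) * norm (rGamma a)"
proof -
  have "a \<notin> \<int>\<^sub>\<le>\<^sub>0" "b \<notin> \<int>\<^sub>\<le>\<^sub>0" using assms by (simp_all add: Re_pos_not_nonpos_Int)
  then have "rGamma (a + b) = Beta a b * rGamma b * rGamma a"
    by (simp add: Beta_altdef rGamma_inverse_Gamma Gamma_eq_zero_iff field_simps)
  then show ?thesis
    using norm_Beta_le[OF assms] by (simp add: norm_mult mult_right_mono)
qed

text \<open>
  The integrand \<open>t powr (X n - 1) * (1 - t) powr (r - 1)\<close> tends to \<open>0\<close> for \<open>0 < t < 1\<close> and is
  dominated by its value for exponent \<open>0\<close> of \<open>t\<close> as soon as \<open>X n \<ge> 1\<close>.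
\<close>

lemma Beta_tendsto_0:
  fixes r :: real
  assumes "r > 0" and X: "filterlim X at_top sequentially"
  shows "(\<lambda>n. Beta (X n) r) \<longlonglongrightarrow> 0"
proof -
  from X have ev: "eventually (\<lambda>n. X n \<ge> 1) sequentially"
    by (simp add: filterlim_at_top)
  then obtain N where N: "\<And>n. n \<ge> N \<Longrightarrow> X n \<ge> 1"
    by (auto simp: eventually_sequentially)
  define f where "f = (\<lambda>c t. indicat_real {0..1} t *\<^sub>R (t powr (c - 1) * (1 - t) powr (r - 1)))"
  have f: "integrable lborel (f c)" "integral\<^sup>L lborel (f c) = Beta c r" if "c > 0" for c
    using integrable_Beta[OF that \<open>r > 0\<close>] has_integral_Beta_real[OF that \<open>r > 0\<close>]
      set_borel_integral_eq_integral(2)[OF integrable_Beta[OF that \<open>r > 0\<close>]]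
    by (simp_all add: f_def set_integrable_def set_lebesgue_integral_def integral_unique)
  have [measurable]: "f c \<in> borel_measurable borel" for c
    by (simp add: f_def)
  have "(\<lambda>n. integral\<^sup>L lborel (f (X (n + N)))) \<longlonglongrightarrow> integral\<^sup>L lborel (\<lambda>_::real. 0)"
  proof (rule integral_dominated_convergence[where w = "f 1"])
    show "AE t in lborel. (\<lambda>n. f (X (n + N)) t) \<longlonglongrightarrow> 0"
      using AE_lborel_singleton[of 1]
    proof eventually_elim
      case (elim t)
      show ?case
      proof (cases "0 < t \<and> t < 1")
        case True
        have "filterlim (\<lambda>n. X (n + N)) at_top sequentially"
          using filterlim_compose[OF X filterlim_add_const_nat_at_top] .
        then have "filterlim (\<lambda>n. (X (n + N) - 1) * (- ln t)) at_top sequentially"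
          using True by (intro filterlim_at_top_mult_tendsto_pos[OF tendsto_const]
              filterlim_tendsto_add_at_top[OF tendsto_const, of _ _ "-1", simplified]) auto
        then have "filterlim (\<lambda>n. (X (n + N) - 1) * ln t) at_bot sequentially"
          by (simp add: filterlim_uminus_at_top)
        then have "(\<lambda>n. exp ((X (n + N) - 1) * ln t)) \<longlonglongrightarrow> 0"
          by (rule filterlim_compose[OF exp_at_bot])
        then have "(\<lambda>n. t powr (X (n + N) - 1) * (1 - t) powr (r - 1)) \<longlonglongrightarrow> 0"
          using True by (intro tendsto_mult_left_zero) (simp add: powr_def)
        then show ?thesis using True by (simp add: f_def)
      next
        case False
        then have "f c t = 0" for c using elim by (auto simp: f_def indicator_def)
        then show ?thesis by simp
      qed
    qed
    show "AE t in lborel. norm (f (X (n + N)) t) \<le> f 1 t" for n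
    proof (rule AE_I2)
      fix t :: real
      have "t powr (X (n + N) - 1) \<le> t powr (1 - 1)" if "0 < t" "t \<le> 1"
        using N[of "n + N"] that by (intro powr_mono') auto
      then show "norm (f (X (n + N)) t) \<le> f 1 t"
        by (cases "t = 0") (auto simp: f_def indicator_def intro!: mult_left_le_one_le)
    qed
  qed (use f in auto)
  also have "(\<lambda>n. integral\<^sup>L lborel (f (X (n + N)))) = (\<lambda>n. Beta (X (n + N)) r)"
  proof
    fix n
    show "integral\<^sup>L lborel (f (X (n + N))) = Beta (X (n + N)) r"
      using N[of "n + N"] by (intro f(2)) auto
  qed
  finally show ?thesis using LIMSEQ_offset by auto
qed

text \<open>
  By \<open>norm_rGamma_add_le\<close> with \<open>b = \<upsilon>\<close>, consecutive terms have ratio at most a constant times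
  \<open>Beta (Re (q + \<upsilon> * n)) (Re \<upsilon>)\<close>, which tends to \<open>0\<close>. The argument only concerns large \<open>n\<close>, where
  the real part of \<open>q + \<upsilon> * n\<close> is positive, so \<open>q\<close> may be any complex number.
\<close>

lemma summable_rGamma_progression:
  assumes "Re \<upsilon> > 0" "R \<ge> 0"
  shows "summable (\<lambda>n. norm (rGamma (q + \<upsilon> * of_nat n)) * R ^ n)"
proof -
  define X where "X = (\<lambda>n. Re q + Re \<upsilon> * real n)"
  have X: "filterlim X at_top sequentially"
    unfolding X_def using assms
    by (intro filterlim_tendsto_add_at_top[OF tendsto_const]
        filterlim_tendsto_pos_mult_at_top[OF tendsto_const] filterlim_real_sequentially) auto
  have "(\<lambda>n. Beta (X n) (Re \<upsilon>) * (norm (rGamma \<upsilon>) * R)) \<longlonglongrightarrow> 0 * (norm (rGamma \<upsilon>) * R)"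
    by (intro tendsto_mult Beta_tendsto_0 X assms tendsto_const)
  then have "eventually (\<lambda>n. Beta (X n) (Re \<upsilon>) * (norm (rGamma \<upsilon>) * R) < 1/2) sequentially"
    by (intro order_tendstoD(2)[where y = 0]) auto
  moreover have "eventually (\<lambda>n. X n > 0) sequentially"
    using X by (simp add: filterlim_at_top_dense)
  ultimately have "eventually (\<lambda>n. Beta (X n) (Re \<upsilon>) * (norm (rGamma \<upsilon>) * R) < 1/2 \<and> X n > 0) sequentially"
    by eventually_elim auto
  then obtain N where N: "Beta (X n) (Re \<upsilon>) * (norm (rGamma \<upsilon>) * R) < 1/2" "X n > 0" if "n \<ge> N" for n
    by (auto simp: eventually_sequentially)
  show ?thesis
  proof (rule summable_ratio_test[of "1/2" N])
    fix n assume n: "N \<le> n"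
    have "norm (rGamma (q + \<upsilon> * of_nat (Suc n))) \<le>
        Beta (X n) (Re \<upsilon>) * norm (rGamma \<upsilon>) * norm (rGamma (q + \<upsilon> * of_nat n))"
      using norm_rGamma_add_le[of "q + \<upsilon> * of_nat n" \<upsilon>] N(2)[OF n] \<open>Re \<upsilon> > 0\<close>
      by (simp add: X_def algebra_simps)
    then have "norm (rGamma (q + \<upsilon> * of_nat (Suc n))) * R ^ Suc n \<le>
        (Beta (X n) (Re \<upsilon>) * norm (rGamma \<upsilon>) * norm (rGamma (q + \<upsilon> * of_nat n))) * R ^ Suc n"
      using \<open>R \<ge> 0\<close> by (intro mult_right_mono) auto
    also have "\<dots> = (Beta (X n) (Re \<upsilon>) * (norm (rGamma \<upsilon>) * R)) * (norm (rGamma (q + \<upsilon> * of_nat n)) * R ^ n)"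
      by simp
    also have "\<dots> \<le> 1/2 * (norm (rGamma (q + \<upsilon> * of_nat n)) * R ^ n)"
      using N(1)[OF n] \<open>R \<ge> 0\<close> by (intro mult_right_mono) auto
    finally show "norm (norm (rGamma (q + \<upsilon> * of_nat (Suc n))) * R ^ Suc n) \<le>
        1/2 * norm (norm (rGamma (q + \<upsilon> * of_nat n)) * R ^ n)"
      using \<open>R \<ge> 0\<close> by simp
  qed simp
qed

section \<open>Fractional calculus of power series weighted by the reciprocal Gamma function\<close>

definition geometrically_bounded :: "(nat \<Rightarrow> complex) \<Rightarrow> bool" where
  "geometrically_bounded a \<longleftrightarrow> (\<exists>K R. 0 \<le> R \<and> (\<forall>n. norm (a n) \<le> K * R ^ n))"

text \<open>
  The superposition \<open>\<Sum>n. a n * rGamma (q + \<upsilon> * n) * s powr (q + \<upsilon> * n - 1)\<close>, written as a power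
  times a power series in \<open>s powr \<upsilon>\<close> so that the theory of entire power series applies.
\<close>

definition rGamma_power_series :: "(nat \<Rightarrow> complex) \<Rightarrow> complex \<Rightarrow> complex \<Rightarrow> real \<Rightarrow> complex" where
  "rGamma_power_series a \<upsilon> q s =
     of_real s powr (q - 1) * (\<Sum>n. a n * rGamma (q + \<upsilon> * of_nat n) * (of_real s powr \<upsilon>) ^ n)"

lemma summable_rGamma_power_series:
  assumes "geometrically_bounded a" "Re \<upsilon> > 0" "r \<ge> 0"
  shows "summable (\<lambda>n. norm (a n * rGamma (q + \<upsilon> * of_nat n)) * r ^ n)"
proof -
  from assms(1) obtain K R where R: "R \<ge> 0" and a: "\<And>n. norm (a n) \<le> K * R ^ n"
    by (auto simp: geometrically_bounded_def)
  show ?thesis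
  proof (rule summable_comparison_test')
    show "summable (\<lambda>n. K * (norm (rGamma (q + \<upsilon> * of_nat n)) * (R * r) ^ n))"
      using assms R by (intro summable_mult summable_rGamma_progression) auto
    fix n :: nat
    have "norm (a n) * (norm (rGamma (q + \<upsilon> * of_nat n)) * r ^ n) \<le>
        (K * R ^ n) * (norm (rGamma (q + \<upsilon> * of_nat n)) * r ^ n)"
      using \<open>r \<ge> 0\<close> by (intro mult_right_mono a) auto
    then show "norm (norm (a n * rGamma (q + \<upsilon> * of_nat n)) * r ^ n) \<le>
        K * (norm (rGamma (q + \<upsilon> * of_nat n)) * (R * r) ^ n)"
      using \<open>r \<ge> 0\<close> by (simp add: norm_mult power_mult_distrib mult_ac)
  qed
qed

lemma summable_rGamma_power_series':
  assumes "geometrically_bounded a" "Re \<upsilon> > 0"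
  shows "summable (\<lambda>n. a n * rGamma (q + \<upsilon> * of_nat n) * u ^ n)"
  using summable_rGamma_power_series[OF assms norm_ge_zero[of u], of q]
  by (intro summable_norm_cancel[of "\<lambda>n. a n * rGamma (q + \<upsilon> * of_nat n) * u ^ n"])
     (simp add: norm_mult norm_power)

lemma powr_progression:
  assumes "s > 0"
  shows "complex_of_real s powr q * (of_real s powr \<upsilon>) ^ n = of_real s powr (q + \<upsilon> * of_nat n)"
proof -
  have "(complex_of_real s powr \<upsilon>) ^ n = of_real s powr (\<upsilon> * of_nat n)"
    using assms by (simp add: powr_def exp_of_nat_mult [symmetric] mult_ac)
  then show ?thesis by (simp add: powr_add)
qed

text \<open>
  Term by term this is \<open>RL_kernel_power\<close>, since
  \<open>rGamma \<mu> * Beta \<mu> \<sigma> = Gamma \<sigma> * rGamma (\<mu> + \<sigma>)\<close>. Sum and integral may be exchanged because the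
  \<open>L\<^sup>1\<close> norms of the terms are summable: the factor \<open>Beta (Re \<mu>) (Re \<sigma>)\<close> decreases in \<open>Re \<mu>\<close> and
  is thus bounded by its value for \<open>n = 0\<close>.
\<close>

lemma RL_integral_rGamma_power_series:
  assumes a: "geometrically_bounded a" and \<upsilon>: "Re \<upsilon> > 0" and q: "Re q > 0" and \<sigma>: "Re \<sigma> > 0"
    and "b < x"
  defines "h \<equiv> \<lambda>y. rGamma_power_series a \<upsilon> q (y - b)"
  shows "set_integrable lborel {b..x} (RL_integrand \<sigma> h x)"
    and "RL_integral b \<sigma> h x = rGamma_power_series a \<upsilon> (q + \<sigma>) (x - b)"
proof -
  define \<mu> where "\<mu> = (\<lambda>n. q + \<upsilon> * of_nat n)"
  have \<mu>: "Re (\<mu> n) > 0" "Re (\<mu> n) \<ge> Re q" for n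
    using q \<upsilon> by (auto simp: \<mu>_def intro!: add_pos_nonneg)
  define c where "c = (\<lambda>n. a n * rGamma (\<mu> n))"
  define k where "k = (\<lambda>n y. complex_of_real (x - y) powr (\<sigma> - 1) * of_real (y - b) powr (\<mu> n - 1))"
  define f where "f = (\<lambda>n y. indicat_real {b..x} y *\<^sub>R (c n * k n y))"
  have k: "set_integrable lborel {b..x} (k n)"
    "(LINT y:{b..x}|lborel. k n y) = Beta (\<mu> n) \<sigma> * of_real (x - b) powr (\<mu> n + \<sigma> - 1)"
    "(LINT y:{b..x}|lborel. norm (k n y)) =
       Beta (Re (\<mu> n)) (Re \<sigma>) * (x - b) powr (Re (\<mu> n) + Re \<sigma> - 1)" for n
    unfolding k_def by (rule RL_kernel_power[OF \<open>b < x\<close> \<sigma> \<mu>(1)])+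
  have c: "summable (\<lambda>n. norm (c n) * r ^ n)" if "r \<ge> 0" for r
    unfolding c_def \<mu>_def by (rule summable_rGamma_power_series[OF a \<upsilon> that])
  have k_geom: "k n y = of_real (x - y) powr (\<sigma> - 1) * of_real (y - b) powr (q - 1) * (of_real (y - b) powr \<upsilon>) ^ n"
    if "y > b" for n y
    using powr_progression[of "y - b" "q - 1" \<upsilon> n] that
    by (simp add: k_def \<mu>_def algebra_simps del: of_real_diff)
  have sum: "summable (\<lambda>n. norm (f n y)) \<and> (\<Sum>n. f n y) = indicat_real {b..x} y *\<^sub>R RL_integrand \<sigma> h x y" for y
  \<comment> \<open>At \<open>y = b\<close> both sides vanish, because \<open>0 powr \<mu> = 0\<close>.\<close>
  proof (cases "b < y \<and> y \<le> x")
    case True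
    define C where "C = complex_of_real (x - y) powr (\<sigma> - 1) * of_real (y - b) powr (q - 1)"
    define u where "u = complex_of_real (y - b) powr \<upsilon>"
    have f: "f n y = C * (c n * u ^ n)" for n
      using True k_geom[of y n] by (simp add: f_def C_def u_def)
    have *: "summable (\<lambda>n. norm (c n * u ^ n))"
      using c[of "norm u"] by (simp add: norm_mult norm_power)
    have "summable (\<lambda>n. norm C * norm (c n * u ^ n))"
      by (rule summable_mult[OF *])
    moreover have "(\<Sum>n. f n y) = C * (\<Sum>n. c n * u ^ n)"
      unfolding f by (rule suminf_mult[OF summable_norm_cancel[OF *]])
    ultimately show ?thesis
      using True by (simp add: f norm_mult RL_integrand_def h_def rGamma_power_series_def C_def c_def \<mu>_def u_def)
  next
    case False
    then have "f n y = 0" for n by (auto simp: f_def k_def indicator_def)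
    moreover have "indicat_real {b..x} y *\<^sub>R RL_integrand \<sigma> h x y = 0"
      using False by (auto simp: RL_integrand_def h_def rGamma_power_series_def indicator_def)
    ultimately show ?thesis by simp
  qed
  have int: "integrable lborel (f n)" for n
    using integrable_mult_right[of "c n", OF k(1)[of n, unfolded set_integrable_def]] by (simp add: f_def)
  have norms: "summable (\<lambda>n. \<integral>y. norm (f n y) \<partial>lborel)"
  proof (rule summable_comparison_test')
    define B where "B = Beta (Re q) (Re \<sigma>) * (x - b) powr (Re q + Re \<sigma> - 1)"
    show "summable (\<lambda>n. B * (norm (c n) * ((x - b) powr Re \<upsilon>) ^ n))"
      by (intro summable_mult c) auto
    fix n :: nat
    have "(\<integral>y. norm (f n y) \<partial>lborel) = norm (c n) * (LINT y:{b..x}|lborel. norm (k n y))"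
      unfolding set_lebesgue_integral_def
      by (subst integral_mult_right_zero [symmetric]) (simp add: f_def norm_mult mult_ac)
    also have "\<dots> = norm (c n) * (Beta (Re (\<mu> n)) (Re \<sigma>) * (x - b) powr (Re (\<mu> n) + Re \<sigma> - 1))"
      by (simp only: k(3))
    also have "(x - b) powr (Re (\<mu> n) + Re \<sigma> - 1) =
        (x - b) powr (Re q + Re \<sigma> - 1) * ((x - b) powr Re \<upsilon>) ^ n"
      using \<open>b < x\<close> by (simp add: \<mu>_def powr_realpow [symmetric] powr_powr powr_add [symmetric] algebra_simps)
    finally have eq: "(\<integral>y. norm (f n y) \<partial>lborel) = norm (c n) * (Beta (Re (\<mu> n)) (Re \<sigma>) *
        ((x - b) powr (Re q + Re \<sigma> - 1) * ((x - b) powr Re \<upsilon>) ^ n))" .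
    have "\<dots> \<le> norm (c n) * (Beta (Re q) (Re \<sigma>) *
        ((x - b) powr (Re q + Re \<sigma> - 1) * ((x - b) powr Re \<upsilon>) ^ n))"
      using \<mu> q \<sigma> by (intro mult_left_mono mult_right_mono Beta_real_mono) auto
    moreover have "norm (\<integral>y. norm (f n y) \<partial>lborel) = (\<integral>y. norm (f n y) \<partial>lborel)"
      by simp
    ultimately show "norm (\<integral>y. norm (f n y) \<partial>lborel) \<le> B * (norm (c n) * ((x - b) powr Re \<upsilon>) ^ n)"
      unfolding eq by (simp add: B_def mult_ac)
  qed
  have ae: "AE y in lborel. summable (\<lambda>n. norm (f n y))"
    using sum by simp
  show "set_integrable lborel {b..x} (RL_integrand \<sigma> h x)"
    using integrable_suminf[OF int ae norms] sum by (simp add: set_integrable_def)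
  have \<Gamma>\<sigma>: "Gamma \<sigma> \<noteq> 0"
    using \<sigma> by (simp add: Gamma_eq_zero_iff Re_pos_not_nonpos_Int)
  have term_int: "integral\<^sup>L lborel (f n) = Gamma \<sigma> * (of_real (x - b) powr (q + \<sigma> - 1) *
      (a n * rGamma (q + \<sigma> + \<upsilon> * of_nat n) * (of_real (x - b) powr \<upsilon>) ^ n))" for n
  proof -
    have "integral\<^sup>L lborel (f n) = c n * (LINT y:{b..x}|lborel. k n y)"
      unfolding set_lebesgue_integral_def
      by (subst integral_mult_right_zero [symmetric]) (simp add: f_def)
    also have "\<dots> = c n * (Beta (\<mu> n) \<sigma> * of_real (x - b) powr (\<mu> n + \<sigma> - 1))"
      by (simp only: k(2))
    also have "of_real (x - b) powr (\<mu> n + \<sigma> - 1) =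
        complex_of_real (x - b) powr (q + \<sigma> - 1) * (of_real (x - b) powr \<upsilon>) ^ n"
      using powr_progression[of "x - b" "q + \<sigma> - 1" \<upsilon> n] \<open>b < x\<close>
      by (simp add: \<mu>_def algebra_simps del: of_real_diff)
    also have "c n * (Beta (\<mu> n) \<sigma> * \<dots>) = (c n * Beta (\<mu> n) \<sigma>) * \<dots>"
      by simp
    also have "c n * Beta (\<mu> n) \<sigma> = Gamma \<sigma> * (a n * rGamma (q + \<sigma> + \<upsilon> * of_nat n))"
    proof -
      have "Gamma (\<mu> n) * rGamma (\<mu> n) = 1"
        using \<mu>(1)[of n] by (simp add: rGamma_inverse_Gamma Gamma_eq_zero_iff Re_pos_not_nonpos_Int)
      then show ?thesis
        by (simp add: c_def Beta_altdef \<mu>_def algebra_simps)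
    qed
    finally show ?thesis by (simp only: mult_ac)
  qed
  have s: "summable (\<lambda>n. a n * rGamma (q + \<sigma> + \<upsilon> * of_nat n) * (of_real (x - b) powr \<upsilon>) ^ n)"
    by (rule summable_rGamma_power_series'[OF a \<upsilon>])
  have "(LINT y:{b..x}|lborel. RL_integrand \<sigma> h x y) = (\<integral>y. (\<Sum>n. f n y) \<partial>lborel)"
    using sum by (simp add: set_lebesgue_integral_def)
  also have "\<dots> = (\<Sum>n. integral\<^sup>L lborel (f n))"
    by (rule integral_suminf[OF int ae norms])
  also have "\<dots> = Gamma \<sigma> * rGamma_power_series a \<upsilon> (q + \<sigma>) (x - b)"
    unfolding term_int rGamma_power_series_def
    by (subst suminf_mult suminf_mult, (intro summable_mult s)+)+ (rule refl)
  finally show "RL_integral b \<sigma> h x = rGamma_power_series a \<upsilon> (q + \<sigma>) (x - b)"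
    using \<Gamma>\<sigma> by (simp add: RL_integral_def)
qed

text \<open>
  With \<open>u = s powr \<upsilon>\<close> and \<open>G\<close> the power series, the product and chain rules produce
  \<open>s powr (q - 2) * ((q - 1) * G u + \<upsilon> * u * G' u)\<close>. The \<open>n\<close>-th coefficient is thereby multiplied by
  \<open>q - 1 + \<upsilon> * n\<close>, which turns \<open>rGamma (q + \<upsilon> * n)\<close> into \<open>rGamma (q - 1 + \<upsilon> * n)\<close>.
\<close>

lemma rGamma_power_series_has_vector_derivative:
  assumes a: "geometrically_bounded a" and \<upsilon>: "Re \<upsilon> > 0" and "s > 0"
  shows "(rGamma_power_series a \<upsilon> q has_vector_derivative rGamma_power_series a \<upsilon> (q - 1) s) (at s)"
proof -
  define c where "c = (\<lambda>n. a n * rGamma (q + \<upsilon> * of_nat n))"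
  define G where "G = (\<lambda>u. \<Sum>n. c n * u ^ n)"
  define G' where "G' = (\<lambda>u. \<Sum>n. diffs c n * u ^ n)"
  define z where "z = complex_of_real s"
  have z: "z \<notin> \<real>\<^sub>\<le>\<^sub>0" "z \<noteq> 0" using \<open>s > 0\<close> by (auto simp: z_def)
  define u where "u = z powr \<upsilon>"
  have c: "summable (\<lambda>n. c n * u ^ n)" for u
    unfolding c_def by (rule summable_rGamma_power_series'[OF a \<upsilon>])
  have G: "(G has_field_derivative G' u) (at u)" for u
    unfolding G_def G'_def by (rule termdiffs_strong_converges_everywhere[OF c])
  have "(\<lambda>n. of_nat n * c n * u ^ (n - Suc 0)) sums G' u"
    unfolding G'_def by (rule diffs_equiv[OF termdiff_converges_all[OF c]])
  from sums_mult[OF this, of u] have uG': "(\<lambda>n. of_nat n * c n * u ^ n) sums (u * G' u)"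
  proof (rule sums_cong[THEN iffD1, rotated])
    fix n show "u * (of_nat n * c n * u ^ (n - Suc 0)) = of_nat n * c n * u ^ n"
      by (cases n) auto
  qed
  have "(\<lambda>n. (q - 1) * (c n * u ^ n) + \<upsilon> * (of_nat n * c n * u ^ n)) sums ((q - 1) * G u + \<upsilon> * (u * G' u))"
    unfolding G_def by (intro sums_add sums_mult uG' summable_sums c)
  moreover have "(q - 1) * (c n * u ^ n) + \<upsilon> * (of_nat n * c n * u ^ n) =
      a n * rGamma (q - 1 + \<upsilon> * of_nat n) * u ^ n" for n
  proof -
    have "rGamma (q - 1 + \<upsilon> * of_nat n) = (q - 1 + \<upsilon> * of_nat n) * rGamma (q + \<upsilon> * of_nat n)"
      using rGamma_plus1[of "q - 1 + \<upsilon> * of_nat n"] by (simp add: algebra_simps)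
    then show ?thesis by (simp only: c_def) (simp add: algebra_simps)
  qed
  ultimately have next_series: "(\<Sum>n. a n * rGamma (q - 1 + \<upsilon> * of_nat n) * u ^ n) = (q - 1) * G u + \<upsilon> * (u * G' u)"
    by (simp add: sums_iff)
  have "((\<lambda>z. G (z powr \<upsilon>)) has_field_derivative G' u * (\<upsilon> * z powr (\<upsilon> - 1))) (at z)"
    unfolding u_def by (rule DERIV_chain2[OF G has_field_derivative_powr[OF z(1)]])
  from DERIV_mult[OF has_field_derivative_powr[OF z(1), of "q - 1"] this]
  have "((\<lambda>z. z powr (q - 1) * G (z powr \<upsilon>)) has_field_derivative
      (q - 1) * z powr (q - 1 - 1) * G u + G' u * (\<upsilon> * z powr (\<upsilon> - 1)) * z powr (q - 1)) (at z)"
    by (simp add: u_def)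
  also have "G' u * (\<upsilon> * z powr (\<upsilon> - 1)) * z powr (q - 1) = z powr (q - 1 - 1) * (\<upsilon> * (u * G' u))"
  proof -
    have "z powr (\<upsilon> - 1) * z powr (q - 1) = z powr (q - 1 - 1) * u"
      by (simp add: u_def powr_add [symmetric] algebra_simps)
    then show ?thesis by (simp add: mult_ac)
  qed
  also have "(q - 1) * z powr (q - 1 - 1) * G u + z powr (q - 1 - 1) * (\<upsilon> * (u * G' u)) =
      rGamma_power_series a \<upsilon> (q - 1) s"
    unfolding rGamma_power_series_def z_def [symmetric] u_def [symmetric] next_series
    by (simp add: algebra_simps)
  finally show ?thesis
    unfolding z_def G_def c_def rGamma_power_series_def [abs_def]
    by (rule has_vector_derivative_real_field)
qed

text \<open>
  Agreement of \<open>g\<close> with the series is assumed only to the right of \<open>b\<close>. That half-line is open,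
  so it determines all derivatives there.
\<close>

lemma iter_deriv_rGamma_power_series:
  assumes a: "geometrically_bounded a" and \<upsilon>: "Re \<upsilon> > 0"
    and g: "\<And>x. x > b \<Longrightarrow> g x = rGamma_power_series a \<upsilon> q (x - b)"
  shows "x > b \<Longrightarrow> iter_deriv k g x = rGamma_power_series a \<upsilon> (q - of_nat k) (x - b)"
    and "x > b \<Longrightarrow> iter_deriv k g differentiable (at x)"
proof -
  have step: "(f has_vector_derivative rGamma_power_series a \<upsilon> (r - 1) (x - b)) (at x)"
    if f: "\<And>x. x > b \<Longrightarrow> f x = rGamma_power_series a \<upsilon> r (x - b)" and "x > b" for f r x
  proof (rule has_vector_derivative_transform_within_open[of _ _ _ "{b<..}"])
    show "((\<lambda>x. rGamma_power_series a \<upsilon> r (x - b)) has_vector_derivative rGamma_power_series a \<upsilon> (r - 1) (x - b)) (at x)"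
    proof -
      have "((\<lambda>x. x - b) has_vector_derivative 1) (at x)"
        by (auto intro!: derivative_eq_intros)
      from vector_diff_chain_at[OF this rGamma_power_series_has_vector_derivative[OF a \<upsilon>, of "x - b" r]]
      show ?thesis using \<open>x > b\<close> by (simp add: o_def)
    qed
  qed (use that in auto)
  have iter: "iter_deriv k g x = rGamma_power_series a \<upsilon> (q - of_nat k) (x - b)" if "x > b" for x k
    using that
  proof (induction k arbitrary: x)
    case 0
    then show ?case by (simp add: iter_deriv_def g)
  next
    case (Suc k)
    have "iter_deriv (Suc k) g x = vector_derivative (iter_deriv k g) (at x)"
      by (simp add: iter_deriv_def)
    also have "\<dots> = rGamma_power_series a \<upsilon> (q - of_nat k - 1) (x - b)"
      by (rule vector_derivative_at, rule step) (use Suc in auto)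
    finally show ?case by (simp add: algebra_simps)
  qed
  show "x > b \<Longrightarrow> iter_deriv k g x = rGamma_power_series a \<upsilon> (q - of_nat k) (x - b)"
    by (rule iter)
  show "x > b \<Longrightarrow> iter_deriv k g differentiable (at x)"
    using step[OF iter] by (auto intro: differentiableI_vector)
qed

section \<open>Reduction of the bivariate series to a single series\<close>

lemma fact_add_le: "fact (l + n) \<le> (2::real) ^ (l + n) * fact l * fact n"
proof -
  have "real ((l + n) choose l) \<le> 2 ^ (l + n)"
    using binomial_le_pow2[of "l + n" l] by (metis of_nat_le_iff of_nat_numeral of_nat_power)
  then show ?thesis
    using binomial_fact[of l "l + n", where 'a = real] by (simp add: field_simps)
qed

lemma norm_pochhammer_le:
  fixes \<gamma> :: complex
  shows "norm (pochhammer \<gamma> k) \<le> (1 + norm \<gamma>) ^ k * fact k"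
proof (induction k)
  case (Suc k)
  have "norm (\<gamma> + of_nat k) \<le> norm \<gamma> + real k"
    by (metis norm_of_nat norm_triangle_ineq)
  also have "\<dots> \<le> (1 + norm \<gamma>) * real (Suc k)"
    by (simp add: algebra_simps)
  finally have "norm (pochhammer \<gamma> k) * norm (\<gamma> + of_nat k) \<le>
      ((1 + norm \<gamma>) ^ k * fact k) * ((1 + norm \<gamma>) * real (Suc k))"
    by (intro mult_mono Suc) auto
  then show ?case by (simp add: pochhammer_Suc norm_mult mult_ac)
qed simp

text \<open>
  No denominator vanishes in the quotients \<open>(j + 1) / (\<gamma> + j)\<close>, and they converge to \<open>1\<close>, so they are
  bounded by some \<open>D\<close>; multiplying them for \<open>j < k\<close> gives the bound.
\<close>

lemma norm_inverse_pochhammer_le: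
  fixes \<gamma> :: complex
  assumes "\<gamma> \<notin> \<int>\<^sub>\<le>\<^sub>0"
  obtains D where "D > 0" "\<And>k. norm (inverse (pochhammer \<gamma> k)) \<le> D ^ k / fact k"
proof -
  have nz: "\<gamma> + of_nat j \<noteq> 0" for j
    using assms by (metis add.commute add_eq_0_iff minus_of_nat_in_nonpos_Ints)
  have "filterlim (\<lambda>j. \<gamma> + of_nat j) at_infinity sequentially"
    by (intro tendsto_add_filterlim_at_infinity[OF tendsto_const] tendsto_of_nat)
  then have "(\<lambda>j. 1 + (1 - \<gamma>) / (\<gamma> + of_nat j)) \<longlonglongrightarrow> 1 + 0"
    by (intro tendsto_add tendsto_const tendsto_divide_0[OF tendsto_const])
  then have "Bseq (\<lambda>j. 1 + (1 - \<gamma>) / (\<gamma> + of_nat j))"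
    by (rule convergent_imp_Bseq[OF convergentI])
  then obtain D where D: "D > 0" "\<And>j. norm (1 + (1 - \<gamma>) / (\<gamma> + of_nat j)) \<le> D"
    by (auto elim: BseqE)
  have j: "norm (inverse (\<gamma> + of_nat j)) \<le> D / real (Suc j)" for j
  proof -
    have "1 + (1 - \<gamma>) / (\<gamma> + of_nat j) = of_nat (Suc j) * inverse (\<gamma> + of_nat j)"
      using nz[of j] by (simp add: field_simps)
    then have "norm (of_nat (Suc j) * inverse (\<gamma> + of_nat j)) \<le> D"
      using D(2)[of j] by simp
    then show ?thesis
      unfolding norm_mult norm_of_nat by (simp add: field_simps del: of_nat_Suc)
  qed
  have "norm (inverse (pochhammer \<gamma> k)) \<le> D ^ k / fact k" for k
  proof (induction k)
    case (Suc k)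
    have "norm (inverse (pochhammer \<gamma> k)) * norm (inverse (\<gamma> + of_nat k)) \<le>
        (D ^ k / fact k) * (D / real (Suc k))"
      using D(1) by (intro mult_mono Suc j) auto
    then show ?case by (simp add: pochhammer_Suc norm_mult norm_inverse mult_ac)
  qed simp
  with D(1) that show ?thesis by blast
qed

text \<open>
  Exchange of integral and sum, with counting measure on the naturals as the measure.
\<close>

lemma suminf_swap_of_product_majorant:
  fixes f :: "nat \<Rightarrow> nat \<Rightarrow> complex"
  assumes "summable A" "summable B" and f: "\<And>l n. norm (f l n) \<le> A l * B n"
  shows "(\<Sum>l. \<Sum>n. f l n) = (\<Sum>n. \<Sum>l. f l n)"
proof -
  have row: "summable (\<lambda>n. norm (f l n))" for l
    by (rule summable_comparison_test'[OF summable_mult[OF assms(2), of "A l"]]) (use f in auto)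
  have col: "summable (\<lambda>l. norm (f l n))" for n
    by (rule summable_comparison_test'[OF summable_mult2[OF assms(1), of "B n"]]) (use f in auto)
  have rows: "summable (\<lambda>l. \<Sum>n. norm (f l n))"
  proof (rule summable_comparison_test'[OF summable_mult2[OF assms(1), of "suminf B"]])
    fix l :: nat
    have "(\<Sum>n. norm (f l n)) \<le> (\<Sum>n. A l * B n)"
      by (intro suminf_le f row summable_mult assms)
    also have "\<dots> = A l * suminf B"
      by (rule suminf_mult[OF assms(2)])
    finally show "norm (\<Sum>n. norm (f l n)) \<le> A l * suminf B"
      using suminf_nonneg[OF row] by simp
  qed
  have int: "integrable (count_space UNIV) (f l)" for l
    using row by (simp add: integrable_count_space_nat_iff)
  have norms: "summable (\<lambda>l. \<integral>n. norm (f l n) \<partial>count_space UNIV)"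
    using rows row by (simp add: integral_count_space_nat integrable_count_space_nat_iff)
  have ae: "AE n in count_space UNIV. summable (\<lambda>l. norm (f l n))"
    using col by simp
  show ?thesis
    using integral_suminf[OF int ae norms] integrable_suminf[OF int ae norms]
    by (simp add: integral_count_space_nat int)
qed

text \<open>
  The part of the \<open>(l, n)\<close> term of the bivariate series that depends neither on \<open>q\<close> nor on \<open>s\<close>.
\<close>

definition IKML_coeff ::
  "complex \<Rightarrow> complex \<Rightarrow> complex \<Rightarrow> complex \<Rightarrow> complex \<Rightarrow> complex \<Rightarrow>
   complex \<Rightarrow> complex \<Rightarrow> complex \<Rightarrow> nat \<Rightarrow> nat \<Rightarrow> complex" where
  "IKML_coeff \<gamma>1 \<gamma>2 \<gamma>3 \<gamma>4 \<gamma>5 \<gamma>6 p z W l n =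
     (-1) ^ l * pochhammer \<gamma>1 (2 * l) * pochhammer \<gamma>2 (l + n) * pochhammer \<gamma>3 l
       * z ^ l * W ^ n * rGamma (p + of_nat l)
     / (pochhammer \<gamma>4 l * pochhammer \<gamma>5 l * pochhammer \<gamma>6 l * fact n * fact l)"

text \<open>
  Up to geometric factors a Pochhammer symbol of length \<open>k\<close> is at most \<open>fact k\<close>, it is at least
  \<open>fact k\<close> for a base outside \<open>{0, -1, -2, \<dots>}\<close>, and \<open>fact (l + n)\<close> is at most
  \<open>fact l * fact n\<close>. In the numerator \<open>(\<gamma>1)\<^sub>2\<^sub>l\<close> thus contributes two factors
  \<open>fact l\<close>, \<open>(\<gamma>2)\<^sub>l\<^sub>+\<^sub>n\<close> one together with \<open>fact n\<close>, and \<open>(\<gamma>3)\<^sub>l\<close> one; the denominator has five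
  factors \<open>fact l\<close>, one of them from \<open>rGamma (p + l) = rGamma p / (p)\<^sub>l\<close>, and one \<open>fact n\<close>. What
  remains is \<open>1 / fact l\<close>.
\<close>

lemma norm_IKML_coeff_le:
  assumes "p \<notin> \<int>\<^sub>\<le>\<^sub>0" "\<gamma>4 \<notin> \<int>\<^sub>\<le>\<^sub>0" "\<gamma>5 \<notin> \<int>\<^sub>\<le>\<^sub>0" "\<gamma>6 \<notin> \<int>\<^sub>\<le>\<^sub>0"
  obtains K M N where "K \<ge> 0" "M \<ge> 0" "N \<ge> 0"
    "\<And>l n. norm (IKML_coeff \<gamma>1 \<gamma>2 \<gamma>3 \<gamma>4 \<gamma>5 \<gamma>6 p z W l n) \<le> K * (M ^ l / fact l) * N ^ n"
proof -
  obtain D0 where D0: "D0 > 0" "\<And>k. norm (inverse (pochhammer p k)) \<le> D0 ^ k / fact k"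
    using norm_inverse_pochhammer_le[OF assms(1)] by blast
  obtain D4 where D4: "D4 > 0" "\<And>k. norm (inverse (pochhammer \<gamma>4 k)) \<le> D4 ^ k / fact k"
    using norm_inverse_pochhammer_le[OF assms(2)] by blast
  obtain D5 where D5: "D5 > 0" "\<And>k. norm (inverse (pochhammer \<gamma>5 k)) \<le> D5 ^ k / fact k"
    using norm_inverse_pochhammer_le[OF assms(3)] by blast
  obtain D6 where D6: "D6 > 0" "\<And>k. norm (inverse (pochhammer \<gamma>6 k)) \<le> D6 ^ k / fact k"
    using norm_inverse_pochhammer_le[OF assms(4)] by blast
  define A1 where "A1 = 1 + norm \<gamma>1"
  define A2 where "A2 = 1 + norm \<gamma>2"
  define A3 where "A3 = 1 + norm \<gamma>3"
  have A: "A1 \<ge> 0" "A2 \<ge> 0" "A3 \<ge> 0" by (auto simp: A1_def A2_def A3_def)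
  define B1 where "B1 = A1 ^ 2 * 4"
  define B2 where "B2 = A2 * 2"
  have B: "B1 \<ge> 0" "B2 \<ge> 0" using A by (auto simp: B1_def B2_def)
  define M where "M = B1 * B2 * A3 * norm z * D0 * D4 * D5 * D6"
  define N where "N = B2 * norm W"
  show thesis
  proof (rule that[of "norm (rGamma p)" M N])
    show "M \<ge> 0" "N \<ge> 0" using A B D0 D4 D5 D6 by (auto simp: M_def N_def)
    fix l n
    have p: "rGamma (p + of_nat l) = rGamma p * inverse (pochhammer p l)"
    proof -
      have "pochhammer p l \<noteq> 0"
        using assms(1) by (auto simp: pochhammer_eq_0_iff)
      then show ?thesis using pochhammer_rGamma[of p l] by (simp add: field_simps)
    qed
    have "norm (pochhammer \<gamma>1 (2 * l)) \<le> A1 ^ (2 * l) * fact (2 * l)"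
      unfolding A1_def by (rule norm_pochhammer_le)
    also have "\<dots> \<le> A1 ^ (2 * l) * (2 ^ (l + l) * fact l * fact l)"
      using fact_add_le[of l l] A by (intro mult_left_mono) (simp_all add: mult_2)
    finally have *: "norm (pochhammer \<gamma>1 (2 * l)) \<le> A1 ^ (2 * l) * (2 ^ (l + l) * fact l * fact l)" .
    have 1: "norm (pochhammer \<gamma>1 (2 * l)) \<le> B1 ^ l * (fact l * fact l)"
    proof -
      have "(2::real) ^ (l + l) = 4 ^ l" "A1 ^ (2 * l) = (A1 ^ 2) ^ l"
        by (simp_all only: power_mult) (simp add: power_add flip: power_mult_distrib)
      with * show ?thesis by (simp only: B1_def power_mult_distrib mult.assoc)
    qed
    have "norm (pochhammer \<gamma>2 (l + n)) \<le> A2 ^ (l + n) * fact (l + n)"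
      unfolding A2_def by (rule norm_pochhammer_le)
    also have "\<dots> \<le> A2 ^ (l + n) * (2 ^ (l + n) * fact l * fact n)"
      using fact_add_le[of l n] A by (intro mult_left_mono) simp_all
    finally have 2: "norm (pochhammer \<gamma>2 (l + n)) \<le> (B2 ^ l * B2 ^ n) * (fact l * fact n)"
      by (simp add: B2_def power_add power_mult_distrib mult_ac)
    have 3: "norm (pochhammer \<gamma>3 l) \<le> A3 ^ l * fact l"
      unfolding A3_def by (rule norm_pochhammer_le)
    have "norm (IKML_coeff \<gamma>1 \<gamma>2 \<gamma>3 \<gamma>4 \<gamma>5 \<gamma>6 p z W l n) =
        norm (pochhammer \<gamma>1 (2 * l)) * norm (pochhammer \<gamma>2 (l + n)) * norm (pochhammer \<gamma>3 l) *
        norm (inverse (pochhammer p l)) * norm (inverse (pochhammer \<gamma>4 l)) *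
        norm (inverse (pochhammer \<gamma>5 l)) * norm (inverse (pochhammer \<gamma>6 l)) *
        (norm z ^ l * norm W ^ n * norm (rGamma p) / (fact n * fact l))"
      by (simp add: IKML_coeff_def p norm_mult norm_divide norm_power norm_inverse field_simps)
    also have "\<dots> \<le> (B1 ^ l * (fact l * fact l)) *
        ((B2 ^ l * B2 ^ n) * (fact l * fact n)) * (A3 ^ l * fact l) *
        (D0 ^ l / fact l) * (D4 ^ l / fact l) * (D5 ^ l / fact l) * (D6 ^ l / fact l) *
        (norm z ^ l * norm W ^ n * norm (rGamma p) / (fact n * fact l))"
      using A B D0 D4 D5 D6 by (intro mult_mono 1 2 3) auto
    also have "\<dots> = norm (rGamma p) * (M ^ l / fact l) * N ^ n"
      by (simp add: M_def N_def power_mult_distrib field_simps)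
    finally show "norm (IKML_coeff \<gamma>1 \<gamma>2 \<gamma>3 \<gamma>4 \<gamma>5 \<gamma>6 p z W l n) \<le>
        norm (rGamma p) * (M ^ l / fact l) * N ^ n" .
  qed auto
qed

text \<open>
  The coefficient bound is a product of a function of \<open>l\<close> and a function of \<open>n\<close>, so the double
  series converges absolutely and the summation over \<open>l\<close> can be carried out first.
\<close>

lemma IKML_eq_rGamma_power_series:
  fixes p q \<upsilon> \<gamma>1 \<gamma>2 \<gamma>3 \<gamma>4 \<gamma>5 \<gamma>6 z W :: complex
  assumes "p \<notin> \<int>\<^sub>\<le>\<^sub>0" "\<gamma>4 \<notin> \<int>\<^sub>\<le>\<^sub>0" "\<gamma>5 \<notin> \<int>\<^sub>\<le>\<^sub>0" "\<gamma>6 \<notin> \<int>\<^sub>\<le>\<^sub>0" "Re \<upsilon> > 0"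
  defines "a \<equiv> \<lambda>n. \<Sum>l. IKML_coeff \<gamma>1 \<gamma>2 \<gamma>3 \<gamma>4 \<gamma>5 \<gamma>6 p z W l n"
  shows "geometrically_bounded a"
    and "s \<ge> 0 \<Longrightarrow> of_real s powr (q - 1) * IKML \<gamma>1 \<gamma>2 \<gamma>3 \<gamma>4 \<gamma>5 \<gamma>6 p q \<upsilon> z W s =
           rGamma_power_series a \<upsilon> q s"
proof -
  let ?c = "IKML_coeff \<gamma>1 \<gamma>2 \<gamma>3 \<gamma>4 \<gamma>5 \<gamma>6 p z W"
  obtain K M N where K: "K \<ge> 0" "M \<ge> 0" "N \<ge> 0"
    and c: "\<And>l n. norm (?c l n) \<le> K * (M ^ l / fact l) * N ^ n"
    using norm_IKML_coeff_le[OF assms(1-4)] by blast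
  have expM: "summable (\<lambda>l. M ^ l / fact l)"
    using summable_exp[of M] by (simp add: divide_inverse mult.commute)
  have c_summable: "summable (\<lambda>l. norm (?c l n))" for n
    by (rule summable_comparison_test'[OF summable_mult2[OF summable_mult[OF expM, of K], of "N ^ n"]])
       (use c in auto)
  have "norm (a n) \<le> (K * (\<Sum>l. M ^ l / fact l)) * N ^ n" for n
  proof -
    have "norm (a n) \<le> (\<Sum>l. norm (?c l n))"
      unfolding a_def by (rule summable_norm[OF c_summable])
    also have "\<dots> \<le> (\<Sum>l. K * (M ^ l / fact l) * N ^ n)"
      by (intro suminf_le c c_summable summable_mult2 summable_mult expM)
    also have "\<dots> = (K * (\<Sum>l. M ^ l / fact l)) * N ^ n"
      by (subst suminf_mult2 [symmetric], intro summable_mult expM) (simp only: suminf_mult[OF expM])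
    finally show ?thesis .
  qed
  with K show "geometrically_bounded a"
    unfolding geometrically_bounded_def by blast
  assume "s \<ge> 0"
  show "of_real s powr (q - 1) * IKML \<gamma>1 \<gamma>2 \<gamma>3 \<gamma>4 \<gamma>5 \<gamma>6 p q \<upsilon> z W s = rGamma_power_series a \<upsilon> q s"
  proof (cases "s = 0")
    case True
    then show ?thesis by (simp add: rGamma_power_series_def)
  next
    case False
    with \<open>s \<ge> 0\<close> have "s > 0" by simp
    define u where "u = complex_of_real s powr \<upsilon>"
    have u: "of_real s powr (\<upsilon> * of_nat n) = u ^ n" for n
      using powr_progression[OF \<open>s > 0\<close>, of 0 \<upsilon> n] False by (simp add: u_def)
    have "IKML \<gamma>1 \<gamma>2 \<gamma>3 \<gamma>4 \<gamma>5 \<gamma>6 p q \<upsilon> z W s =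
        (\<Sum>l. \<Sum>n. ?c l n * (rGamma (q + \<upsilon> * of_nat n) * u ^ n))"
      unfolding IKML_def IKML_coeff_def u by (intro suminf_cong) (simp add: mult_ac)
    also have "\<dots> = (\<Sum>n. \<Sum>l. ?c l n * (rGamma (q + \<upsilon> * of_nat n) * u ^ n))"
    proof (rule suminf_swap_of_product_majorant)
      show "summable (\<lambda>l. K * (M ^ l / fact l))"
        by (intro summable_mult expM)
      show "summable (\<lambda>n. norm (rGamma (q + \<upsilon> * of_nat n)) * (N * norm u) ^ n)"
        using K by (intro summable_rGamma_progression assms) auto
      fix l n
      have "norm (?c l n) * (norm (rGamma (q + \<upsilon> * of_nat n)) * norm u ^ n) \<le>
          (K * (M ^ l / fact l) * N ^ n) * (norm (rGamma (q + \<upsilon> * of_nat n)) * norm u ^ n)"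
        by (intro mult_right_mono c) auto
      then show "norm (?c l n * (rGamma (q + \<upsilon> * of_nat n) * u ^ n)) \<le>
          K * (M ^ l / fact l) * (norm (rGamma (q + \<upsilon> * of_nat n)) * (N * norm u) ^ n)"
        by (simp add: norm_mult norm_power power_mult_distrib mult_ac)
    qed
    also have "\<dots> = (\<Sum>n. a n * rGamma (q + \<upsilon> * of_nat n) * u ^ n)"
      unfolding a_def
      by (subst suminf_mult2 [symmetric, OF summable_norm_cancel[OF c_summable]]) (simp add: mult_ac)
    finally show ?thesis by (simp add: rGamma_power_series_def u_def)
  qed
qed

section \<open>The fractional derivative of the Mittag-Leffler function\<close>

theorem theorem50:
  fixes p q \<upsilon> \<gamma>1 \<gamma>2 \<gamma>3 \<gamma>4 \<gamma>5 \<gamma>6 \<tau> w W z :: complex and b t :: real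
  assumes "Re p > 0" and "Re q > 0" and "Re \<upsilon> > 0"
    and "\<gamma>4 \<notin> \<int>\<^sub>\<le>\<^sub>0" and "\<gamma>5 \<notin> \<int>\<^sub>\<le>\<^sub>0" and "\<gamma>6 \<notin> \<int>\<^sub>\<le>\<^sub>0"
    and "Re \<tau> \<ge> 0" and "Re (q - \<tau>) \<ge> 0"
    and "is_power_value w \<upsilon> W"
    and "t > b"
  defines "h \<equiv> \<lambda>y. of_real (y - b) powr (q - 1) * IKML \<gamma>1 \<gamma>2 \<gamma>3 \<gamma>4 \<gamma>5 \<gamma>6 p q \<upsilon> z W (y - b)"
  shows "RL_deriv_exists b \<tau> h \<and>
    RL_deriv b \<tau> h t =
      of_real (t - b) powr (q - \<tau> - 1) * IKML \<gamma>1 \<gamma>2 \<gamma>3 \<gamma>4 \<gamma>5 \<gamma>6 p (q - \<tau>) \<upsilon> z W (t - b)"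
proof -
  define a where "a = (\<lambda>n. \<Sum>l. IKML_coeff \<gamma>1 \<gamma>2 \<gamma>3 \<gamma>4 \<gamma>5 \<gamma>6 p z W l n)"
  define h' where "h' = (\<lambda>y. rGamma_power_series a \<upsilon> q (y - b))"
  define m where "m = RL_order \<tau>"
  define \<sigma> where "\<sigma> = of_nat m - \<tau>"
  note IKML_series = IKML_eq_rGamma_power_series[OF Re_pos_not_nonpos_Int[OF \<open>Re p > 0\<close>] assms(4-6,3)]
  have a: "geometrically_bounded a"
    unfolding a_def by (rule IKML_series(1))
  have IKML: "of_real s powr (r - 1) * IKML \<gamma>1 \<gamma>2 \<gamma>3 \<gamma>4 \<gamma>5 \<gamma>6 p r \<upsilon> z W s = rGamma_power_series a \<upsilon> r s"
    if "s \<ge> 0" for r s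
    unfolding a_def by (rule IKML_series(2)[OF that])
  have \<sigma>: "Re \<sigma> > 0"
    unfolding \<sigma>_def m_def RL_order_def using \<open>Re \<tau> \<ge> 0\<close> by simp linarith
  have h: "h y = h' y" if "y \<ge> b" for y
    using that IKML[of "y - b" q] by (simp add: h_def h'_def)
  have integrand: "indicat_real {b..x} y *\<^sub>R RL_integrand \<sigma> h x y =
      indicat_real {b..x} y *\<^sub>R RL_integrand \<sigma> h' x y" for x y
    by (auto simp: RL_integrand_def h indicator_def)
  have integrable: "set_integrable lborel {b..x} (RL_integrand \<sigma> h x)" if "x > b" for x
    using RL_integral_rGamma_power_series(1)[OF a \<open>Re \<upsilon> > 0\<close> \<open>Re q > 0\<close> \<sigma> that]
    unfolding set_integrable_def integrand by (simp add: h'_def)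
  have integral: "RL_integral b \<sigma> h x = rGamma_power_series a \<upsilon> (q + \<sigma>) (x - b)" if "x > b" for x
    using RL_integral_rGamma_power_series(2)[OF a \<open>Re \<upsilon> > 0\<close> \<open>Re q > 0\<close> \<sigma> that]
    unfolding RL_integral_def set_lebesgue_integral_def integrand by (simp add: h'_def)
  note iter = iter_deriv_rGamma_power_series[OF a \<open>Re \<upsilon> > 0\<close> integral]
  have "RL_deriv_exists b \<tau> h"
    unfolding RL_deriv_exists_def Let_def m_def [symmetric] \<sigma>_def [symmetric]
    using integrable iter(2) by blast
  moreover have "RL_deriv b \<tau> h t = rGamma_power_series a \<upsilon> (q - \<tau>) (t - b)"
    unfolding RL_deriv_def m_def [symmetric] \<sigma>_def [symmetric]
    using iter(1)[OF _ \<open>t > b\<close>, of m] by (simp add: \<sigma>_def)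
  ultimately show ?thesis
    using IKML[of "t - b" "q - \<tau>"] \<open>t > b\<close> by simp
qed

end
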